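(* Let $(V,\sigma)$ be a symplectic $\widetilde{\mathbb R}$-module, where $V$ is free and of finite rank $m\in\mathbb N$. Then $m$ is even, say $m=2n$, and $V$ possesses a symplectic basis, i.e., a basis $\{e_1,\dots,e_n,f_1,\dots,f_n\}$ such that $$\sigma(e_j,e_l)=0=\sigma(f_j,f_l),\qquad \sigma(f_j,e_l)=\delta_{jl}\qquad(1\le j,l\le n).$$
   Context: Let $I=(0,1]$. The ring of Colombeau generalized real numbers is $\widetilde{\mathbb R}=\mathcal E_M/\mathcal N$, where $\mathcal E_M=\{(r_\varepsilon)_{\varepsilon\in I}\in\mathbb R^I:\exists N\in\mathbb N,\ |r_\varepsilon|=O(\varepsilon^{-N})\ (\varepsilon\to0)\}$ and $\mathcal N=\{(r_\varepsilon)_{\varepsilon\in I}\in\mathbb R^I:\forall m\in\mathbb N,\ |r_\varepsilon|=O(\varepsilon^{m})\ (\varepsilon\to0)\}$, with operations defined componentwise on representatives; it is a commutative ring with unit. Let $V$ be an $\widetilde{\mathbb R}$-module. An $\widetilde{\mathbb R}$-bilinear form $\sigma:V\times V\to\widetilde{\mathbb R}$ is a symplectic form on $V$ if it is skew-symmetric ($\sigma(v,w)=-\sigma(w,v)$ for all $v,w\in V$) and non-degenerate (if $w\in V$ satisfies $\sigma(v,w)=0$ for all $v\in V$, then $w=0$). The pair $(V,\sigma)$ is then called a symplectic $\widetilde{\mathbb R}$-module. $\delta_{jl}$ is the Kronecker delta. *)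

theory Defs
  imports Complex_Main "HOL-Library.Landau_Symbols"
begin

section \<open>Colombeau generalized real numbers\<close>

text \<open>
  A net indexed by \<open>I = (0,1]\<close> is represented by a total function on the reals whose values
  outside of \<open>I\<close> are irrelevant: moderateness and negligibility only refer to the filter of
  neighbourhoods of \<open>0\<close> within \<open>I\<close>, so the quotient below identifies any two moderate functions
  that agree on \<open>I\<close>.
\<close>

abbreviation eps_to_0 :: "real filter" where
  "eps_to_0 \<equiv> at 0 within {0<..1}"

definition moderate :: "(real \<Rightarrow> real) \<Rightarrow> bool" where
  "moderate r \<longleftrightarrow> (\<exists>N::nat. r \<in> O[eps_to_0](\<lambda>\<epsilon>. 1 / \<epsilon> ^ N))"

definition negligible_net :: "(real \<Rightarrow> real) \<Rightarrow> bool" where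
  "negligible_net r \<longleftrightarrow> (\<forall>m::nat. r \<in> O[eps_to_0](\<lambda>\<epsilon>. \<epsilon> ^ m))"

definition gen_real_rel :: "(real \<Rightarrow> real) \<Rightarrow> (real \<Rightarrow> real) \<Rightarrow> bool" where
  "gen_real_rel r s \<longleftrightarrow> moderate r \<and> moderate s \<and> negligible_net (\<lambda>\<epsilon>. r \<epsilon> - s \<epsilon>)"

lemma eventually_eps_to_0: "eventually (\<lambda>\<epsilon>. \<epsilon> \<in> {0<..1}) eps_to_0"
  by (simp add: eventually_at_filter)

lemma eps_to_0_neq_bot: "eps_to_0 \<noteq> bot"
proof -
  have "eps_to_0 = at_right (0::real)"
    by (rule at_within_nhd[of _ "{-1<..<1}"]) auto
  then show ?thesis by simp
qed

lemma moderate_const: "moderate (\<lambda>_. c)"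
  unfolding moderate_def by (rule exI[of _ 0]) simp

lemma inverse_power_bigo:
  assumes "N \<le> M"
  shows "(\<lambda>\<epsilon>::real. 1 / \<epsilon> ^ N) \<in> O[eps_to_0](\<lambda>\<epsilon>. 1 / \<epsilon> ^ M)"
proof (rule landau_o.big_mono, rule eventually_mono[OF eventually_eps_to_0])
  fix \<epsilon> :: real assume e: "\<epsilon> \<in> {0<..1}"
  then have "\<epsilon> ^ M \<le> \<epsilon> ^ N" using assms by (intro power_decreasing) auto
  then show "norm (1 / \<epsilon> ^ N) \<le> norm (1 / \<epsilon> ^ M)" using e by (simp add: frac_le)
qed

lemma moderate_add:
  assumes "moderate r" "moderate s"
  shows "moderate (\<lambda>\<epsilon>. r \<epsilon> + s \<epsilon>)"
proof -
  obtain N M where N: "r \<in> O[eps_to_0](\<lambda>\<epsilon>. 1 / \<epsilon> ^ N)" and M: "s \<in> O[eps_to_0](\<lambda>\<epsilon>. 1 / \<epsilon> ^ M)"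
    using assms unfolding moderate_def by auto
  have "r \<in> O[eps_to_0](\<lambda>\<epsilon>. 1 / \<epsilon> ^ max N M)" "s \<in> O[eps_to_0](\<lambda>\<epsilon>. 1 / \<epsilon> ^ max N M)"
    by (rule landau_o.big_trans[OF N] landau_o.big_trans[OF M],
        rule inverse_power_bigo, simp)+
  then show ?thesis unfolding moderate_def by (intro exI[of _ "max N M"] sum_in_bigo)
qed

lemma moderate_mult:
  assumes "moderate r" "moderate s"
  shows "moderate (\<lambda>\<epsilon>. r \<epsilon> * s \<epsilon>)"
proof -
  obtain N M where N: "r \<in> O[eps_to_0](\<lambda>\<epsilon>. 1 / \<epsilon> ^ N)" and M: "s \<in> O[eps_to_0](\<lambda>\<epsilon>. 1 / \<epsilon> ^ M)"
    using assms unfolding moderate_def by auto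
  from landau_o.big_mult[OF N M] show ?thesis
    unfolding moderate_def by (intro exI[of _ "N + M"]) (simp add: power_add)
qed

lemma moderate_uminus: "moderate r \<Longrightarrow> moderate (\<lambda>\<epsilon>. - r \<epsilon>)"
  unfolding moderate_def by simp

lemma moderate_diff: "moderate r \<Longrightarrow> moderate s \<Longrightarrow> moderate (\<lambda>\<epsilon>. r \<epsilon> - s \<epsilon>)"
  using moderate_add[of r "\<lambda>\<epsilon>. - s \<epsilon>"] by (simp add: moderate_uminus)

lemma negligible_net_0: "negligible_net (\<lambda>_. 0)"
  unfolding negligible_net_def by simp

lemma negligible_net_add:
  "negligible_net r \<Longrightarrow> negligible_net s \<Longrightarrow> negligible_net (\<lambda>\<epsilon>. r \<epsilon> + s \<epsilon>)"
  unfolding negligible_net_def by (auto intro: sum_in_bigo)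

lemma negligible_net_uminus: "negligible_net r \<Longrightarrow> negligible_net (\<lambda>\<epsilon>. - r \<epsilon>)"
  unfolding negligible_net_def by simp

lemma negligible_net_mult:
  assumes "negligible_net r" "moderate s"
  shows "negligible_net (\<lambda>\<epsilon>. r \<epsilon> * s \<epsilon>)"
  unfolding negligible_net_def
proof
  fix m :: nat
  obtain N where N: "s \<in> O[eps_to_0](\<lambda>\<epsilon>. 1 / \<epsilon> ^ N)"
    using assms(2) unfolding moderate_def by auto
  have "r \<in> O[eps_to_0](\<lambda>\<epsilon>. \<epsilon> ^ (m + N))"
    using assms(1) unfolding negligible_net_def by blast
  from landau_o.big_mult[OF this N]
  have "(\<lambda>\<epsilon>. r \<epsilon> * s \<epsilon>) \<in> O[eps_to_0](\<lambda>\<epsilon>. \<epsilon> ^ (m + N) * (1 / \<epsilon> ^ N))" .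
  also have "O[eps_to_0](\<lambda>\<epsilon>::real. \<epsilon> ^ (m + N) * (1 / \<epsilon> ^ N)) = O[eps_to_0](\<lambda>\<epsilon>. \<epsilon> ^ m)"
    by (rule landau_o.big.cong, rule eventually_mono[OF eventually_eps_to_0])
       (simp add: power_add)
  finally show "(\<lambda>\<epsilon>. r \<epsilon> * s \<epsilon>) \<in> O[eps_to_0](\<lambda>\<epsilon>. \<epsilon> ^ m)" .
qed

lemma not_negligible_net_1: "\<not> negligible_net (\<lambda>_. 1)"
proof
  assume "negligible_net (\<lambda>_. 1)"
  then have "(\<lambda>_. 1::real) \<in> O[eps_to_0](\<lambda>\<epsilon>. \<epsilon> ^ 1)"
    unfolding negligible_net_def by blast
  moreover have "((\<lambda>\<epsilon>::real. \<epsilon>) \<longlongrightarrow> 0) eps_to_0"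
    by (rule tendsto_ident_at)
  then have "(\<lambda>\<epsilon>::real. \<epsilon> ^ 1) \<in> o[eps_to_0](\<lambda>_. 1)"
    by (intro smalloI_tendsto) simp_all
  ultimately have "(\<lambda>_. 1::real) \<in> o[eps_to_0](\<lambda>_. 1::real)"
    by (rule landau_o.big_small_trans)
  then show False
    using eps_to_0_neq_bot by (simp add: landau_o.small_refl_iff)
qed

lemma gen_real_rel_refl: "moderate r \<Longrightarrow> gen_real_rel r r"
  unfolding gen_real_rel_def by (simp add: negligible_net_0)

lemma part_equivp_gen_real_rel: "part_equivp gen_real_rel"
proof (rule part_equivpI)
  show "\<exists>r. gen_real_rel r r"
    using gen_real_rel_refl[OF moderate_const] by blast
  show "symp gen_real_rel"
  proof (rule sympI)
    fix r s assume "gen_real_rel r s"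
    then show "gen_real_rel s r"
      using negligible_net_uminus[of "\<lambda>\<epsilon>. r \<epsilon> - s \<epsilon>"] unfolding gen_real_rel_def by simp
  qed
  show "transp gen_real_rel"
  proof (rule transpI)
    fix r s t assume "gen_real_rel r s" "gen_real_rel s t"
    then show "gen_real_rel r t"
      using negligible_net_add[of "\<lambda>\<epsilon>. r \<epsilon> - s \<epsilon>" "\<lambda>\<epsilon>. s \<epsilon> - t \<epsilon>"]
      unfolding gen_real_rel_def by simp
  qed
qed

quotient_type gen_real = "real \<Rightarrow> real" / partial: gen_real_rel
  by (rule part_equivp_gen_real_rel)

instantiation gen_real :: comm_ring_1
begin

lift_definition zero_gen_real :: gen_real is "\<lambda>_. 0"
  by (rule gen_real_rel_refl[OF moderate_const])

lift_definition one_gen_real :: gen_real is "\<lambda>_. 1"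
  by (rule gen_real_rel_refl[OF moderate_const])

lift_definition plus_gen_real :: "gen_real \<Rightarrow> gen_real \<Rightarrow> gen_real" is "\<lambda>r s \<epsilon>. r \<epsilon> + s \<epsilon>"
proof -
  fix r r' s s' assume "gen_real_rel r r'" "gen_real_rel s s'"
  then show "gen_real_rel (\<lambda>\<epsilon>. r \<epsilon> + s \<epsilon>) (\<lambda>\<epsilon>. r' \<epsilon> + s' \<epsilon>)"
    using negligible_net_add[of "\<lambda>\<epsilon>. r \<epsilon> - r' \<epsilon>" "\<lambda>\<epsilon>. s \<epsilon> - s' \<epsilon>"]
    unfolding gen_real_rel_def by (simp add: moderate_add algebra_simps)
qed

lift_definition uminus_gen_real :: "gen_real \<Rightarrow> gen_real" is "\<lambda>r \<epsilon>. - r \<epsilon>"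
proof -
  fix r r' assume "gen_real_rel r r'"
  then show "gen_real_rel (\<lambda>\<epsilon>. - r \<epsilon>) (\<lambda>\<epsilon>. - r' \<epsilon>)"
    using negligible_net_uminus[of "\<lambda>\<epsilon>. r \<epsilon> - r' \<epsilon>"]
    unfolding gen_real_rel_def by (simp add: moderate_uminus)
qed

lift_definition minus_gen_real :: "gen_real \<Rightarrow> gen_real \<Rightarrow> gen_real" is "\<lambda>r s \<epsilon>. r \<epsilon> - s \<epsilon>"
proof -
  fix r r' s s' assume "gen_real_rel r r'" "gen_real_rel s s'"
  then show "gen_real_rel (\<lambda>\<epsilon>. r \<epsilon> - s \<epsilon>) (\<lambda>\<epsilon>. r' \<epsilon> - s' \<epsilon>)"
    using negligible_net_add[of "\<lambda>\<epsilon>. r \<epsilon> - r' \<epsilon>" "\<lambda>\<epsilon>. - (s \<epsilon> - s' \<epsilon>)"]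
      negligible_net_uminus[of "\<lambda>\<epsilon>. s \<epsilon> - s' \<epsilon>"]
    unfolding gen_real_rel_def by (simp add: moderate_diff algebra_simps)
qed

lift_definition times_gen_real :: "gen_real \<Rightarrow> gen_real \<Rightarrow> gen_real" is "\<lambda>r s \<epsilon>. r \<epsilon> * s \<epsilon>"
proof -
  fix r r' s s' assume "gen_real_rel r r'" "gen_real_rel s s'"
  then show "gen_real_rel (\<lambda>\<epsilon>. r \<epsilon> * s \<epsilon>) (\<lambda>\<epsilon>. r' \<epsilon> * s' \<epsilon>)"
    using negligible_net_add[of "\<lambda>\<epsilon>. (r \<epsilon> - r' \<epsilon>) * s \<epsilon>" "\<lambda>\<epsilon>. (s \<epsilon> - s' \<epsilon>) * r' \<epsilon>"]
      negligible_net_mult[of "\<lambda>\<epsilon>. r \<epsilon> - r' \<epsilon>" s] negligible_net_mult[of "\<lambda>\<epsilon>. s \<epsilon> - s' \<epsilon>" r']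
    unfolding gen_real_rel_def by (simp add: moderate_mult algebra_simps)
qed

instance
proof
  fix a b c :: gen_real
  show "a + b + c = a + (b + c)"
    by transfer (simp add: gen_real_rel_def moderate_add negligible_net_0 add.assoc)
  show "a + b = b + a"
    by transfer (simp add: gen_real_rel_def moderate_add negligible_net_0 add.commute)
  show "0 + a = a"
    by transfer (simp add: gen_real_rel_def)
  show "- a + a = 0"
    by transfer (simp add: gen_real_rel_def moderate_const negligible_net_0)
  show "a - b = a + - b"
    by transfer (simp add: gen_real_rel_def moderate_add moderate_uminus moderate_diff negligible_net_0)
  show "a * b * c = a * (b * c)"
    by transfer (simp add: gen_real_rel_def moderate_mult negligible_net_0 mult.assoc)
  show "a * b = b * a"
    by transfer (simp add: gen_real_rel_def moderate_mult negligible_net_0 mult.commute)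
  show "1 * a = a"
    by transfer (simp add: gen_real_rel_def)
  show "(a + b) * c = a * c + b * c"
    by transfer
      (simp add: gen_real_rel_def moderate_mult moderate_add negligible_net_0 distrib_right)
  show "(0::gen_real) \<noteq> 1"
    by transfer
      (use not_negligible_net_1 negligible_net_uminus[of "\<lambda>_. - 1"] in
        \<open>auto simp: gen_real_rel_def\<close>)
qed

end


section \<open>Free modules and symplectic modules\<close>

definition module_basis :: "('a::comm_ring_1 \<Rightarrow> 'b::ab_group_add \<Rightarrow> 'b) \<Rightarrow> 'b set \<Rightarrow> bool" where
  "module_basis scale B \<longleftrightarrow> \<not> module.dependent scale B \<and> module.span scale B = UNIV"

definition free_of_rank :: "('a::comm_ring_1 \<Rightarrow> 'b::ab_group_add \<Rightarrow> 'b) \<Rightarrow> nat \<Rightarrow> bool" where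
  "free_of_rank scale m \<longleftrightarrow> (\<exists>B. module_basis scale B \<and> finite B \<and> card B = m)"

text \<open>The module \<open>V\<close> is the whole type \<open>'v\<close>, with scalar multiplication \<open>scale\<close>.\<close>

locale symplectic_module = module scale
  for scale :: "gen_real \<Rightarrow> 'v::ab_group_add \<Rightarrow> 'v" +
  fixes \<sigma> :: "'v \<Rightarrow> 'v \<Rightarrow> gen_real"
  assumes linear_left: "\<And>w. module_hom scale (*) (\<lambda>v. \<sigma> v w)"
    and linear_right: "\<And>v. module_hom scale (*) (\<lambda>w. \<sigma> v w)"
    and skew_symmetric: "\<And>v w. \<sigma> v w = - \<sigma> w v"
    and nondegenerate: "\<And>w. (\<And>v. \<sigma> v w = 0) \<Longrightarrow> w = 0"
begin

text \<open>The cardinality condition says that the \<open>2n\<close> listed vectors are pairwise distinct.\<close>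

definition symplectic_basis :: "nat \<Rightarrow> (nat \<Rightarrow> 'v) \<Rightarrow> (nat \<Rightarrow> 'v) \<Rightarrow> bool" where
  "symplectic_basis n e f \<longleftrightarrow>
     module_basis scale (e ` {1..n} \<union> f ` {1..n}) \<and> card (e ` {1..n} \<union> f ` {1..n}) = 2 * n \<and>
     (\<forall>j\<in>{1..n}. \<forall>l\<in>{1..n}.
        \<sigma> (e j) (e l) = 0 \<and> \<sigma> (f j) (f l) = 0 \<and> \<sigma> (f j) (e l) = (if j = l then 1 else 0))"

end

end

theory Submission
  imports Defs
begin

text \<open>
  Suppose part of a basis already consists of hyperbolic pairs orthogonal to all other basis
  vectors, and let \<open>e\<close> be one of these others, with \<open>b i\<close> the remaining ones. Choose signs \<open>s i\<close>
  with \<open>s i * \<sigma> (b i) e = \<bar>\<sigma> (b i) e\<bar>\<close>. A generalized real number is a unit or is annihilated by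
  the nonzero characteristic function of a set of parameters, and in the latter case for
  \<open>c = \<Sum>\<bar>\<sigma> (b i) e\<bar>\<close> that function would annihilate \<open>e\<close>, by non-degeneracy. So \<open>c\<close> is a unit and
  \<open>f = c\<inverse> \<Sum> s i \<cdot> b i\<close> satisfies \<open>\<sigma> f e = 1\<close>. Although the ring is not local, \<open>f\<close> can be
  exchanged for any \<open>b i\<close>, since its coefficient \<open>c\<inverse> s i\<close> is a unit. Projecting the other \<open>b i\<close>
  along \<open>e\<close> and \<open>f\<close> finishes the step.
\<close>

section \<open>Nets: units and zero divisors\<close>

lemma eventually_eps_to_0_iff:
  "eventually P eps_to_0 \<longleftrightarrow> (\<exists>\<delta>>0. \<forall>\<epsilon>\<in>{0<..1}. \<epsilon> < \<delta> \<longrightarrow> P \<epsilon>)"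
  by (auto simp: eventually_at dist_real_def)

lemma moderate_mono:
  assumes "moderate s" "\<And>\<epsilon>. \<bar>r \<epsilon>\<bar> \<le> \<bar>s \<epsilon>\<bar>"
  shows "moderate r"
proof -
  have "r \<in> O[eps_to_0](s)" using assms(2) by (intro landau_o.big_mono) simp
  with assms(1) show ?thesis unfolding moderate_def by (blast intro: landau_o.big_trans)
qed

lemma negligible_net_mono:
  assumes "negligible_net s" "\<And>\<epsilon>. \<bar>r \<epsilon>\<bar> \<le> \<bar>s \<epsilon>\<bar>"
  shows "negligible_net r"
proof -
  have "r \<in> O[eps_to_0](s)" using assms(2) by (intro landau_o.big_mono) simp
  with assms(1) show ?thesis unfolding negligible_net_def by (blast intro: landau_o.big_trans)
qed

lemma moderate_sum:
  "(\<And>i. i \<in> I \<Longrightarrow> moderate (r i)) \<Longrightarrow> moderate (\<lambda>\<epsilon>. \<Sum>i\<in>I. r i \<epsilon>)"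
  by (induction I rule: infinite_finite_induct) (auto intro: moderate_add moderate_const)

text \<open>If \<open>c\<close> eventually dominates some power of \<epsilon>, its pointwise
  reciprocal is moderate. Otherwise \<open>c\<close> is smaller than every power along points
  tending to 0, and the characteristic function of suitable such points annihilates it.\<close>

lemma net_unit_or_zero_divisor:
  assumes nonneg: "\<And>\<epsilon>. 0 \<le> c \<epsilon>"
  shows "(\<exists>d. moderate d \<and> negligible_net (\<lambda>\<epsilon>. c \<epsilon> * d \<epsilon> - 1)) \<or>
    (\<exists>x. moderate x \<and> \<not> negligible_net x \<and> negligible_net (\<lambda>\<epsilon>. x \<epsilon> * c \<epsilon>))"
proof (cases "\<exists>N. eventually (\<lambda>\<epsilon>. \<epsilon> ^ N \<le> c \<epsilon>) eps_to_0")
  case True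
  then obtain N where "eventually (\<lambda>\<epsilon>. \<epsilon> ^ N \<le> c \<epsilon>) eps_to_0" ..
  with eventually_eps_to_0 have ev: "eventually (\<lambda>\<epsilon>. 0 < \<epsilon> ^ N \<and> \<epsilon> ^ N \<le> c \<epsilon>) eps_to_0"
    by eventually_elim auto
  \<comment> \<open>Where \<open>c\<close> vanishes, \<open>1 / c\<close> has the default value 0;
    by \<open>ev\<close> this does not happen for small parameters in (0,1].\<close>
  then have "eventually (\<lambda>\<epsilon>. norm (1 / c \<epsilon>) \<le> norm (1 / \<epsilon> ^ N)) eps_to_0"
    by eventually_elim (auto simp: nonneg intro!: frac_le)
  then have "moderate (\<lambda>\<epsilon>. 1 / c \<epsilon>)"
    unfolding moderate_def by (blast intro: landau_o.big_mono)
  moreover have "(\<lambda>\<epsilon>. c \<epsilon> * (1 / c \<epsilon>) - 1) \<in> O[eps_to_0](\<lambda>\<epsilon>. \<epsilon> ^ m)" for m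
    by (rule landau_o.big_mono, rule eventually_mono[OF ev]) auto
  then have "negligible_net (\<lambda>\<epsilon>. c \<epsilon> * (1 / c \<epsilon>) - 1)"
    by (simp add: negligible_net_def)
  ultimately show ?thesis by blast
next
  case False
  \<comment> \<open>The bound \<open>1 / real (Suc N)\<close> forces the chosen points to tend to
    0.\<close>
  have "\<exists>\<epsilon>. 0 < \<epsilon> \<and> \<epsilon> \<le> 1 \<and> \<epsilon> < 1 / real (Suc N) \<and> c \<epsilon> < \<epsilon> ^ N" for N
  proof (rule ccontr)
    assume "\<not> ?thesis"
    then have "\<forall>\<epsilon>\<in>{0<..1}. \<epsilon> < 1 / real (Suc N) \<longrightarrow> \<epsilon> ^ N \<le> c \<epsilon>"
      by (auto simp: not_less)
    then have "eventually (\<lambda>\<epsilon>. \<epsilon> ^ N \<le> c \<epsilon>) eps_to_0"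
      unfolding eventually_eps_to_0_iff by (intro exI[of _ "1 / real (Suc N)"]) simp
    with False show False by blast
  qed
  then obtain t where t: "\<And>N. 0 < t N" "\<And>N. t N \<le> 1" "\<And>N. t N < 1 / real (Suc N)"
      "\<And>N. c (t N) < t N ^ N"
    by metis
  define x :: "real \<Rightarrow> real" where "x = (\<lambda>\<epsilon>. of_bool (\<epsilon> \<in> range t))"
  have "moderate x"
    by (rule moderate_mono[OF moderate_const[of 1]]) (simp add: x_def)
  moreover have "\<not> negligible_net x"
  proof
    assume "negligible_net x"
    then have "x \<in> O[eps_to_0](\<lambda>\<epsilon>. \<epsilon> ^ 1)"
      unfolding negligible_net_def by blast
    then obtain K where K: "K > 0" "eventually (\<lambda>\<epsilon>. norm (x \<epsilon>) \<le> K * norm (\<epsilon> ^ 1)) eps_to_0"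
      by (elim landau_o.bigE)
    then obtain \<delta> where \<delta>: "\<delta> > 0" "\<And>\<epsilon>. \<epsilon> \<in> {0<..1} \<Longrightarrow> \<epsilon> < \<delta> \<Longrightarrow> x \<epsilon> \<le> K * \<epsilon>"
      unfolding eventually_eps_to_0_iff by force
    \<comment> \<open>At \<open>t N\<close> the net \<open>x\<close> equals 1, whereas the alleged
      bound \<open>K * t N\<close> is below 1.\<close>
    obtain N where N: "1 / real (Suc N) < min \<delta> (1 / K)"
      using nat_approx_posE[of "min \<delta> (1 / K)"] K(1) \<delta>(1) by auto
    have "t N < \<delta>" "t N < 1 / K" using t(3)[of N] N by linarith+
    moreover have "x (t N) = 1" by (simp add: x_def)
    ultimately show False using \<delta>(2)[of "t N"] t(1,2)[of N] K(1) by (simp add: field_simps)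
  qed
  moreover have "negligible_net (\<lambda>\<epsilon>. x \<epsilon> * c \<epsilon>)"
    unfolding negligible_net_def
  proof
    fix m :: nat
    \<comment> \<open>Points of \<open>range t\<close> below this \<delta> can only be
      \<open>t N\<close> with \<open>N \<ge> m\<close>; the inserted 1 covers
      \<open>m = 0\<close>.\<close>
    define \<delta> where "\<delta> = Min (insert 1 (t ` {..<m}))"
    have "\<delta> > 0" using t(1) by (simp add: \<delta>_def)
    moreover have "norm (x \<epsilon> * c \<epsilon>) \<le> norm (\<epsilon> ^ m)" if \<epsilon>: "\<epsilon> \<in> {0<..1}" "\<epsilon> < \<delta>" for \<epsilon>
    proof (cases "\<epsilon> \<in> range t")
      case True
      then obtain N where N: "\<epsilon> = t N" by blast
      have "m \<le> N"
      proof (rule ccontr)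
        assume "\<not> m \<le> N"
        then have "\<delta> \<le> t N" unfolding \<delta>_def by (intro Min_le) auto
        with \<epsilon>(2) N show False by simp
      qed
      then have "\<epsilon> ^ N \<le> \<epsilon> ^ m" using \<epsilon>(1) by (intro power_decreasing) auto
      with t(4)[of N] N \<epsilon>(1) nonneg[of \<epsilon>] True show ?thesis by (simp add: x_def)
    qed (simp add: x_def)
    ultimately have "eventually (\<lambda>\<epsilon>. norm (x \<epsilon> * c \<epsilon>) \<le> norm (\<epsilon> ^ m)) eps_to_0"
      unfolding eventually_eps_to_0_iff by blast
    then show "(\<lambda>\<epsilon>. x \<epsilon> * c \<epsilon>) \<in> O[eps_to_0](\<lambda>\<epsilon>. \<epsilon> ^ m)"
      by (rule landau_o.big_mono)
  qed
  ultimately show ?thesis by blast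
qed

section \<open>Generalized real numbers through their representatives\<close>

lemma gen_real_cases:
  obtains r where "moderate r" "a = abs_gen_real r"
proof -
  have "\<exists>r. moderate r \<and> a = abs_gen_real r"
    by (induction a rule: gen_real.abs_induct) (auto simp: gen_real_rel_def)
  with that show ?thesis by blast
qed

lemma abs_gen_real_eq_iff:
  "moderate r \<Longrightarrow> moderate s \<Longrightarrow>
    abs_gen_real r = abs_gen_real s \<longleftrightarrow> negligible_net (\<lambda>\<epsilon>. r \<epsilon> - s \<epsilon>)"
  using Quotient_rel[OF Quotient_gen_real, of r s]
  by (simp add: gen_real_rel_def negligible_net_0)

lemma abs_gen_real_mult:
  "moderate r \<Longrightarrow> moderate s \<Longrightarrow>
    abs_gen_real r * abs_gen_real s = abs_gen_real (\<lambda>\<epsilon>. r \<epsilon> * s \<epsilon>)"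
  by (simp add: times_gen_real.abs_eq gen_real_rel_refl)

lemma abs_gen_real_sum:
  "(\<And>i. i \<in> I \<Longrightarrow> moderate (r i)) \<Longrightarrow>
    (\<Sum>i\<in>I. abs_gen_real (r i)) = abs_gen_real (\<lambda>\<epsilon>. \<Sum>i\<in>I. r i \<epsilon>)"
  by (induction I rule: infinite_finite_induct)
    (auto simp: zero_gen_real.abs_eq plus_gen_real.abs_eq gen_real_rel_refl moderate_sum)

text \<open>If \<open>2 * r\<close> is negligible, then so is \<open>r\<close>. This makes a
  skew-symmetric form alternating.\<close>

lemma gen_real_eq_0_if_eq_uminus:
  fixes a :: gen_real
  assumes "a = - a"
  shows "a = 0"
proof -
  obtain r where r: "moderate r" "a = abs_gen_real r" by (rule gen_real_cases)
  have "abs_gen_real r = abs_gen_real (\<lambda>\<epsilon>. - r \<epsilon>)"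
    using assms r by (simp add: uminus_gen_real.abs_eq gen_real_rel_refl)
  then have "negligible_net (\<lambda>\<epsilon>. r \<epsilon> - - r \<epsilon>)"
    using r(1) abs_gen_real_eq_iff moderate_uminus by blast
  then have "negligible_net r" by (rule negligible_net_mono) simp
  then show ?thesis
    using r by (simp add: zero_gen_real.abs_eq abs_gen_real_eq_iff moderate_const)
qed

text \<open>
  With \<open>s i\<close> the sign of \<open>a i\<close>, the sum is \<open>\<Sum>\<bar>a i\<bar>\<close>, so whatever annihilates it annihilates
  every \<open>a i\<close>.
\<close>

lemma gen_real_signed_sum:
  fixes a :: "'i \<Rightarrow> gen_real"
  assumes "finite I"
  obtains s where "\<And>i. s i * s i = 1"
    "(\<exists>d. (\<Sum>i\<in>I. s i * a i) * d = 1) \<or> (\<exists>x. x \<noteq> 0 \<and> (\<forall>i\<in>I. x * a i = 0))"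
proof -
  have "\<forall>i. \<exists>r. moderate r \<and> a i = abs_gen_real r"
    by (metis gen_real_cases)
  then obtain r where r: "\<And>i. moderate (r i)" "\<And>i. a i = abs_gen_real (r i)"
    by metis
  \<comment> \<open>The sign at 0 is taken to be 1, so that \<open>s i\<close> is its own inverse
    even where \<open>r i\<close> vanishes.\<close>
  define sg where "sg i = (\<lambda>\<epsilon>. if 0 \<le> r i \<epsilon> then 1 else - 1 :: real)" for i
  define s where "s i = abs_gen_real (sg i)" for i
  have sg: "moderate (sg i)" for i
    by (rule moderate_mono[OF moderate_const[of 1]]) (simp add: sg_def)
  define c where "c = (\<lambda>\<epsilon>. \<Sum>i\<in>I. \<bar>r i \<epsilon>\<bar>)"
  have abs_r: "moderate (\<lambda>\<epsilon>. \<bar>r i \<epsilon>\<bar>)" for i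
    by (rule moderate_mono[OF r(1)[of i]]) simp
  have c: "moderate c" unfolding c_def by (rule moderate_sum) (rule abs_r)
  have "s i * a i = abs_gen_real (\<lambda>\<epsilon>. \<bar>r i \<epsilon>\<bar>)" for i
  proof -
    have "(\<lambda>\<epsilon>. sg i \<epsilon> * r i \<epsilon>) = (\<lambda>\<epsilon>. \<bar>r i \<epsilon>\<bar>)" by (auto simp: sg_def)
    then show ?thesis by (simp add: s_def r sg abs_gen_real_mult)
  qed
  then have sum: "(\<Sum>i\<in>I. s i * a i) = abs_gen_real c"
    by (simp add: abs_gen_real_sum abs_r c_def)
  have "s i * s i = 1" for i
  proof -
    have "(\<lambda>\<epsilon>. sg i \<epsilon> * sg i \<epsilon>) = (\<lambda>\<epsilon>. 1)" by (auto simp: sg_def)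
    then show ?thesis by (simp add: s_def sg abs_gen_real_mult one_gen_real.abs_eq)
  qed
  moreover have "(\<exists>d. abs_gen_real c * d = 1) \<or> (\<exists>x. x \<noteq> 0 \<and> (\<forall>i\<in>I. x * a i = 0))"
  proof -
    have "0 \<le> c \<epsilon>" for \<epsilon> by (simp add: c_def sum_nonneg)
    from net_unit_or_zero_divisor[of c, OF this] show ?thesis
    proof (elim disjE exE conjE)
      fix d assume "moderate d" "negligible_net (\<lambda>\<epsilon>. c \<epsilon> * d \<epsilon> - 1)"
      then have "abs_gen_real c * abs_gen_real d = 1"
        using c by (simp add: abs_gen_real_mult one_gen_real.abs_eq abs_gen_real_eq_iff
            moderate_mult moderate_const)
      then show ?thesis by blast
    next
      fix x assume x: "moderate x" "\<not> negligible_net x" "negligible_net (\<lambda>\<epsilon>. x \<epsilon> * c \<epsilon>)"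
      have "abs_gen_real x \<noteq> 0"
        using x by (simp add: zero_gen_real.abs_eq abs_gen_real_eq_iff moderate_const)
      moreover have "abs_gen_real x * a i = 0" if "i \<in> I" for i
      proof -
        have "\<bar>r i \<epsilon>\<bar> \<le> c \<epsilon>" for \<epsilon>
          unfolding c_def using assms that by (intro member_le_sum) auto
        then have "\<bar>x \<epsilon> * r i \<epsilon>\<bar> \<le> \<bar>x \<epsilon> * c \<epsilon>\<bar>" for \<epsilon>
          unfolding abs_mult by (intro mult_left_mono) (auto intro: order_trans[OF _ abs_ge_self])
        with x(3) have "negligible_net (\<lambda>\<epsilon>. x \<epsilon> * r i \<epsilon>)" by (rule negligible_net_mono)
        then show ?thesis
          using x(1) r by (simp add: abs_gen_real_mult zero_gen_real.abs_eq abs_gen_real_eq_iff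
              moderate_mult moderate_const)
      qed
      ultimately show ?thesis by blast
    qed
  qed
  ultimately show ?thesis using that[of s] sum by simp
qed


section \<open>Indexed bases over a commutative ring\<close>

text \<open>Families instead of sets turn replacing one basis vector into a function update, with
  distinctness a consequence of independence.\<close>

definition basis_on ::
    "('a::comm_ring_1 \<Rightarrow> 'b::ab_group_add \<Rightarrow> 'b) \<Rightarrow> 'i set \<Rightarrow> ('i \<Rightarrow> 'b) \<Rightarrow> bool" where
  "basis_on scale I b \<longleftrightarrow> (\<forall>v. \<exists>c. v = (\<Sum>i\<in>I. scale (c i) (b i))) \<and>
    (\<forall>c. (\<Sum>i\<in>I. scale (c i) (b i)) = 0 \<longrightarrow> (\<forall>i\<in>I. c i = 0))"

context module
begin

lemma basis_on_span: "basis_on scale I b \<Longrightarrow> \<exists>c. v = (\<Sum>i\<in>I. scale (c i) (b i))"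
  by (simp add: basis_on_def)

lemma basis_on_independent:
  "basis_on scale I b \<Longrightarrow> (\<Sum>i\<in>I. scale (c i) (b i)) = 0 \<Longrightarrow> i \<in> I \<Longrightarrow> c i = 0"
  by (simp add: basis_on_def)

text \<open>Although the ring may have zero divisors, basis vectors are torsion-free: the single
  term \<open>scale x (b i)\<close> is already a linear relation.\<close>

lemma basis_on_annihilator:
  assumes "finite I" "basis_on scale I b" "i \<in> I" "scale x (b i) = 0"
  shows "x = 0"
proof -
  have "(\<Sum>j\<in>I. scale (if j = i then x else 0) (b j)) = (\<Sum>j\<in>I. if j = i then scale x (b i) else 0)"
    by (rule sum.cong) auto
  also have "\<dots> = 0" using assms by simp
  finally show ?thesis using basis_on_independent[OF assms(2) _ assms(3)] by force
qed

lemma basis_on_iff_module_basis: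
  assumes "finite I"
  shows "basis_on scale I b \<longleftrightarrow> inj_on b I \<and> module_basis scale (b ` I)"
proof
  assume basis: "basis_on scale I b"
  have inj: "inj_on b I"
  proof (rule inj_onI, rule ccontr)
    fix i j assume ij: "i \<in> I" "j \<in> I" "b i = b j" "i \<noteq> j"
    \<comment> \<open>Two equal vectors satisfy the relation \<open>b i - b j = 0\<close>, whose
      coefficient at \<open>i\<close> is 1.\<close>
    define c :: "_ \<Rightarrow> 'a" where "c k = (if k = i then 1 else 0) - (if k = j then 1 else 0)" for k
    have "(\<Sum>k\<in>I. scale (c k) (b k)) =
        (\<Sum>k\<in>I. if k = i then b k else 0) - (\<Sum>k\<in>I. if k = j then b k else 0)"
      unfolding sum_subtractf[symmetric] by (rule sum.cong) (auto simp: c_def)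
    also have "\<dots> = 0" using assms ij by simp
    finally have "c i = 0" by (rule basis_on_independent[OF basis _ ij(1)])
    then show False using ij by (simp add: c_def)
  qed
  have "v \<in> span (b ` I)" for v
    using basis_on_span[OF basis, of v] by (auto intro: span_sum span_scale span_base)
  moreover have "independent (b ` I)"
    using basis_on_independent[OF basis, of "u \<circ> b" for u] assms
    by (auto simp: dependent_finite sum.reindex[OF inj])
  ultimately show "inj_on b I \<and> module_basis scale (b ` I)"
    using inj by (auto simp: module_basis_def)
next
  assume "inj_on b I \<and> module_basis scale (b ` I)"
  then have inj: "inj_on b I" and ind: "independent (b ` I)" and span: "span (b ` I) = UNIV"
    by (auto simp: module_basis_def)
  have "\<exists>c. v = (\<Sum>i\<in>I. scale (c i) (b i))" for v
  proof -
    have "v \<in> span (b ` I)" by (simp add: span)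
    then obtain u where "v = (\<Sum>w\<in>b ` I. scale (u w) w)"
      using assms by (auto simp: span_finite)
    then show ?thesis by (auto simp: sum.reindex[OF inj] intro!: exI[of _ "u \<circ> b"])
  qed
  moreover have "c i = 0" if "(\<Sum>i\<in>I. scale (c i) (b i)) = 0" "i \<in> I" for c i
  proof -
    have "(\<Sum>w\<in>b ` I. scale ((c \<circ> inv_into I b) w) w) = 0"
      using that inj by (simp add: sum.reindex)
    with ind assms have "(c \<circ> inv_into I b) (b i) = 0"
      using that(2) unfolding dependent_finite[OF finite_imageI[OF assms]] by blast
    then show ?thesis using inj that(2) by simp
  qed
  ultimately show "basis_on scale I b" by (auto simp: basis_on_def)
qed

text \<open>Steinitz exchange over a ring: since \<open>d j\<close> is a unit with inverse
  \<open>u\<close>, the old \<open>b j\<close> can be recovered from the new vector and the other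
  \<open>b i\<close>.\<close>

lemma basis_on_exchange:
  assumes "finite I" "basis_on scale I b" "j \<in> I" and unit: "d j * u = 1"
  shows "basis_on scale I (b(j := (\<Sum>i\<in>I. scale (d i) (b i))))"
proof -
  let ?b = "b(j := (\<Sum>i\<in>I. scale (d i) (b i)))"
  have expand: "(\<Sum>i\<in>I. scale (c i) (?b i)) =
      (\<Sum>i\<in>I. scale ((if i = j then 0 else c i) + c j * d i) (b i))" for c
  proof -
    have "(\<Sum>i\<in>I. scale (c i) (?b i)) =
        (\<Sum>i\<in>I. scale (if i = j then 0 else c i) (b i) + (if i = j then scale (c j) (?b j) else 0))"
      by (rule sum.cong) auto
    also have "\<dots> = (\<Sum>i\<in>I. scale (if i = j then 0 else c i) (b i)) + scale (c j) (?b j)"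
      using assms by (simp add: sum.distrib)
    finally show ?thesis
      by (simp add: scale_sum_right scale_left_distrib sum.distrib)
  qed
  have "\<exists>c. v = (\<Sum>i\<in>I. scale (c i) (?b i))" for v
  proof -
    obtain c where c: "v = (\<Sum>i\<in>I. scale (c i) (b i))" using basis_on_span[OF assms(2)] by blast
    \<comment> \<open>Inverts \<open>expand\<close>: the coefficient at \<open>j\<close> is divided
      by \<open>d j\<close>, and the share of the new vector in the other coordinates is
      subtracted.\<close>
    define c' where "c' i = (if i = j then c j * u else c i - c j * u * d i)" for i
    have "(\<Sum>i\<in>I. scale (c' i) (?b i)) = v"
      unfolding expand c
      by (rule sum.cong) (use unit in \<open>auto simp: c'_def mult.assoc mult.commute[of u]\<close>)
    then show ?thesis by metis
  qed
  moreover have "c i = 0" if "(\<Sum>i\<in>I. scale (c i) (?b i)) = 0" "i \<in> I" for c i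
  proof -
    have coeff: "(if i = j then 0 else c i) + c j * d i = 0" if "i \<in> I" for i
      by (rule basis_on_independent[OF assms(2) _ that])
        (use \<open>(\<Sum>i\<in>I. scale (c i) (?b i)) = 0\<close> in \<open>simp only: expand\<close>)
    from coeff[OF assms(3)] have "c j * d j = 0" by simp
    then have "c j * (d j * u) = 0" by (simp flip: mult.assoc)
    then have "c j = 0" using unit by simp
    with coeff[OF that(2)] show ?thesis by (auto split: if_splits)
  qed
  ultimately show ?thesis unfolding basis_on_def by blast
qed

text \<open>The vectors indexed by \<open>J\<close> are changed one at a time, each by an exchange
  with unit coefficient 1. Disjointness keeps the vectors indexed by \<open>K\<close> fixed
  throughout.\<close>

lemma basis_on_shear:
  assumes "finite I" "basis_on scale I b" "J \<subseteq> I" "K \<subseteq> I" "J \<inter> K = {}"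
  shows "basis_on scale I (\<lambda>i. if i \<in> J then b i + (\<Sum>k\<in>K. scale (p i k) (b k)) else b i)"
proof -
  have "finite J" using assms finite_subset by blast
  then show ?thesis using assms(3,5)
  proof (induction J rule: finite_induct)
    case empty
    then show ?case using assms(2) by simp
  next
    case (insert j J)
    let ?b = "\<lambda>i. if i \<in> J then b i + (\<Sum>k\<in>K. scale (p i k) (b k)) else b i"
    define d where "d i = (if i = j then 1 else if i \<in> K then p j i else 0)" for i
    have "basis_on scale I ?b" using insert by simp
    from basis_on_exchange[OF assms(1) this, of j d 1]
    have "basis_on scale I (?b(j := (\<Sum>i\<in>I. scale (d i) (?b i))))"
      using insert by (simp add: d_def)
    moreover have "(\<Sum>i\<in>I. scale (d i) (?b i)) = b j + (\<Sum>k\<in>K. scale (p j k) (b k))"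
    proof -
      have "(\<Sum>i\<in>I. scale (d i) (?b i)) =
          (\<Sum>i\<in>I. (if i = j then b j else 0) + (if i \<in> K then scale (p j i) (b i) else 0))"
        using insert by (intro sum.cong) (auto simp: d_def)
      also have "\<dots> = b j + (\<Sum>i\<in>I \<inter> K. scale (p j i) (b i))"
        using insert assms(1) by (simp add: sum.distrib sum.inter_restrict)
      finally show ?thesis using assms(4) by (simp add: Int_absorb1)
    qed
    moreover have "?b(j := b j + (\<Sum>k\<in>K. scale (p j k) (b k))) =
        (\<lambda>i. if i \<in> insert j J then b i + (\<Sum>k\<in>K. scale (p i k) (b k)) else b i)"
      by auto
    ultimately show ?case by simp
  qed
qed

end

section \<open>Splitting off hyperbolic pairs\<close>

text \<open>The Gram matrix of a symplectic basis listed from index 0 as e, f, e, f, ...\<close>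

definition standard_form :: "nat \<Rightarrow> nat \<Rightarrow> gen_real" where
  "standard_form i j =
    (if odd i \<and> i = Suc j then 1 else if even i \<and> j = Suc i then - 1 else 0)"

lemma standard_form_eq_0: "i < 2 * k \<Longrightarrow> 2 * k \<le> j \<Longrightarrow> standard_form i j = 0"
  by (auto simp: standard_form_def elim: oddE evenE)

context symplectic_module
begin

sublocale left: module_hom scale "(*)" "\<lambda>v. \<sigma> v w" for w by (rule linear_left)
sublocale right: module_hom scale "(*)" "\<lambda>w. \<sigma> v w" for v by (rule linear_right)

lemma alternating [simp]: "\<sigma> v v = 0"
  using skew_symmetric gen_real_eq_0_if_eq_uminus by blast

lemma basis_on_nondegenerate:
  assumes "basis_on scale I b" "\<And>i. i \<in> I \<Longrightarrow> \<sigma> (b i) w = 0"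
  shows "w = 0"
proof (rule nondegenerate)
  fix v
  obtain c where "v = (\<Sum>i\<in>I. scale (c i) (b i))" using basis_on_span[OF assms(1)] by blast
  then show "\<sigma> v w = 0" using assms(2) by (simp add: left.sum left.scale)
qed

text \<open>
  The first \<open>k\<close> hyperbolic pairs are \<open>(b (2 * i), b (2 * i + 1))\<close>, the role of \<open>e\<close> being played
  by the even indices. As \<open>j\<close> ranges over all indices below \<open>m\<close>, the condition also makes these
  pairs orthogonal to the rest of the basis.
\<close>

definition split_basis :: "nat \<Rightarrow> nat \<Rightarrow> (nat \<Rightarrow> 'v) \<Rightarrow> bool" where
  "split_basis m k b \<longleftrightarrow> basis_on scale {..<m} b \<and>
    (\<forall>i<2 * k. \<forall>j<m. \<sigma> (b i) (b j) = standard_form i j)"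

text \<open>Besides the new pair, the step yields \<open>2 * k + 1 < m\<close>: a single leftover
  vector is impossible. This is the source of the parity claim.\<close>

lemma split_basis_step:
  assumes "split_basis m k b" "2 * k < m"
  shows "2 * k + 1 < m \<and> (\<exists>b'. split_basis m (Suc k) b')"
proof -
  have basis: "basis_on scale {..<m} b"
    and std: "\<And>i j. i < 2 * k \<Longrightarrow> j < m \<Longrightarrow> \<sigma> (b i) (b j) = standard_form i j"
    using assms(1) by (auto simp: split_basis_def)
  define e where "e = b (2 * k)"
  \<comment> \<open>Only these indices can pair nontrivially with \<open>e\<close>: the earlier
    pairs are orthogonal to it and \<open>\<sigma> e e = 0\<close>.\<close>
  let ?I = "{2 * k<..<m}"
  obtain s where s: "\<And>i. s i * s i = 1" and
    or: "(\<exists>d. (\<Sum>i\<in>?I. s i * \<sigma> (b i) e) * d = 1) \<or>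
      (\<exists>x. x \<noteq> 0 \<and> (\<forall>i\<in>?I. x * \<sigma> (b i) e = 0))"
    using gen_real_signed_sum[of ?I "\<lambda>i. \<sigma> (b i) e"] by blast
  have "\<exists>d. (\<Sum>i\<in>?I. s i * \<sigma> (b i) e) * d = 1"
    using or
  proof (elim disjE exE conjE)
    fix x assume "x \<noteq> 0" and x: "\<forall>i\<in>?I. x * \<sigma> (b i) e = 0"
    have "scale x e = 0"
    proof (rule basis_on_nondegenerate[OF basis])
      fix i assume "i \<in> {..<m}"
      then consider "i < 2 * k" | "i = 2 * k" | "i \<in> ?I" by fastforce
      then show "\<sigma> (b i) (scale x e) = 0"
      proof cases
        case 1
        then have "\<sigma> (b i) e = 0"
          using std[OF 1 assms(2)] by (simp add: e_def standard_form_eq_0)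
        then show ?thesis by (simp add: right.scale)
      qed (use x in \<open>simp_all add: right.scale e_def\<close>)
    qed
    then have "x = 0"
      using basis_on_annihilator[OF _ basis, of "2 * k" x] assms(2) by (simp add: e_def)
    with \<open>x \<noteq> 0\<close> show ?thesis by blast
  qed blast
  then obtain d where d: "(\<Sum>i\<in>?I. s i * \<sigma> (b i) e) * d = 1" ..
  \<comment> \<open>An empty sum would give \<open>0 * d = 1\<close>.\<close>
  then have "?I \<noteq> {}" by force
  then obtain i where "i \<in> ?I" by blast
  then have m: "2 * k + 1 < m" by simp
  define f where "f = (\<Sum>i\<in>?I. scale (d * s i) (b i))"
  have fe: "\<sigma> f e = 1"
  proof -
    have "\<sigma> f e = (\<Sum>i\<in>?I. s i * \<sigma> (b i) e) * d"
      unfolding f_def left.sum left.scale sum_distrib_right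
      by (rule sum.cong) (simp_all only: mult_ac)
    with d show ?thesis by simp
  qed
  then have ef: "\<sigma> e f = - 1" using skew_symmetric[of e f] by simp
  define b1 where "b1 = b(2 * k + 1 := f)"
  have "f = (\<Sum>i<m. scale (if i \<in> ?I then d * s i else 0) (b i))"
    unfolding f_def by (rule sum.mono_neutral_cong_left) auto
  \<comment> \<open>\<open>u\<close> inverts the coefficient of \<open>f\<close> at
    \<open>2 * k + 1\<close>, because the sum is inverse to \<open>d\<close> and
    \<open>s (2 * k + 1)\<close> squares to 1.\<close>
  moreover define u where "u = (\<Sum>i\<in>?I. s i * \<sigma> (b i) e) * s (2 * k + 1)"
  have "d * s (2 * k + 1) * u =
      ((\<Sum>i\<in>?I. s i * \<sigma> (b i) e) * d) * (s (2 * k + 1) * s (2 * k + 1))"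
    unfolding u_def by (simp only: mult_ac)
  then have "d * s (2 * k + 1) * u = 1"
    unfolding d s by simp
  ultimately have basis1: "basis_on scale {..<m} b1"
    unfolding b1_def using m
      basis_on_exchange[OF _ basis, of "2 * k + 1" "\<lambda>i. if i \<in> ?I then d * s i else 0" u]
    by simp
  have b1: "b1 (2 * k) = e" "b1 (2 * k + 1) = f" by (simp_all add: b1_def e_def)
  have "\<sigma> (b i) f = 0" if "i < 2 * k" for i
    using that std
    by (auto simp: f_def right.sum right.scale standard_form_eq_0 intro!: sum.neutral)
  then have std1: "\<sigma> (b1 i) (b1 j) = standard_form i j" if "i < 2 * k" "j < m" for i j
    using that std by (auto simp: b1_def standard_form_eq_0)
  let ?J = "{2 * k + 2..<m}" and ?K = "{2 * k, 2 * k + 1}"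
  \<comment> \<open>Coefficients of the projection
    \<open>v - \<sigma> f v \<cdot> e + \<sigma> e v \<cdot> f\<close>; with
    \<open>\<sigma> f e = 1\<close> and \<open>\<sigma> e f = - 1\<close> the result is orthogonal
    to both \<open>e\<close> and \<open>f\<close>.\<close>
  define p where "p i l = (if l = 2 * k then - \<sigma> f (b1 i) else \<sigma> e (b1 i))" for i l
  define b2 where "b2 i =
    (if i \<in> ?J then b1 i + (\<Sum>l\<in>?K. scale (p i l) (b1 l)) else b1 i)" for i
  have basis2: "basis_on scale {..<m} b2"
    unfolding b2_def using m by (intro basis_on_shear[OF _ basis1]) auto
  have b2_J: "b2 i = b1 i + (scale (- \<sigma> f (b1 i)) e + scale (\<sigma> e (b1 i)) f)" if "i \<in> ?J" for i
    using that b1 by (simp add: b2_def p_def)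
  have b2_K: "b2 i = b1 i" if "i \<notin> ?J" for i using that unfolding b2_def by (rule if_not_P)
  have std2: "\<sigma> (b2 i) (b2 j) = standard_form i j" if i: "i < 2 * k + 2" and j: "j < m" for i j
  proof -
    have b2_i: "b2 i = b1 i" using i by (intro b2_K) simp
    have low: "\<sigma> e (b1 l) = 0" "\<sigma> f (b1 l) = 0" if "l < 2 * k" for l
      using std1[OF that, of "2 * k"] std1[OF that, of "2 * k + 1"] that m b1
        skew_symmetric[of e "b1 l"] skew_symmetric[of f "b1 l"]
      by (simp_all add: standard_form_eq_0)
    consider "i < 2 * k" | "i = 2 * k" | "i = 2 * k + 1" using i by linarith
    then show ?thesis
    proof cases
      \<comment> \<open>The projection adds only multiples of \<open>e\<close> and \<open>f\<close>,
        both orthogonal to the earlier pairs, so the old values survive.\<close>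
      case 1
      have "\<sigma> (b1 i) e = 0" "\<sigma> (b1 i) f = 0"
        using std1[OF 1, of "2 * k"] std1[OF 1, of "2 * k + 1"] 1 m b1
        by (simp_all add: standard_form_eq_0)
      then show ?thesis
        using std1[OF 1 j] unfolding b2_i
        by (cases "j \<in> ?J") (simp_all add: b2_J b2_K right.add right.diff right.scale)
    next
      case 2
      have "\<sigma> e (b2 j) = standard_form (2 * k) j"
      proof -
        consider "j < 2 * k" | "j = 2 * k" | "j = 2 * k + 1" | "j \<in> ?J" using j by fastforce
        then show ?thesis
          by cases (use b1 in
              \<open>simp_all add: low b2_J b2_K right.add right.diff right.scale ef fe standard_form_def\<close>)
      qed
      then show ?thesis unfolding b2_i unfolding 2 b1 .
    next
      case 3
      have "\<sigma> f (b2 j) = standard_form (2 * k + 1) j"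
      proof -
        consider "j < 2 * k" | "j = 2 * k" | "j = 2 * k + 1" | "j \<in> ?J" using j by fastforce
        then show ?thesis
          by cases (use b1 in
              \<open>simp_all add: low b2_J b2_K right.add right.diff right.scale ef fe standard_form_def\<close>)
      qed
      then show ?thesis unfolding b2_i unfolding 3 b1 .
    qed
  qed
  show ?thesis using m basis2 std2 by (auto simp: split_basis_def)
qed

section \<open>Extracting the symplectic basis and the parity of the rank\<close>

lemma split_basis_exists:
  assumes "basis_on scale {..<m} b0" "2 * k \<le> m"
  shows "\<exists>b. split_basis m k b"
  using assms(2)
proof (induction k)
  case 0
  then show ?case using assms(1) by (auto simp: split_basis_def)
next
  case (Suc k)
  then show ?case using split_basis_step by force
qed

text \<open>Pure reindexing: the interleaved list starting at 0 is separated into two families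
  starting at 1.\<close>

lemma symplectic_basis_if_split_basis:
  assumes "split_basis (2 * n) n b"
  shows "symplectic_basis n (\<lambda>j. b (2 * (j - 1))) (\<lambda>j. b (2 * (j - 1) + 1))"
proof -
  let ?e = "\<lambda>j. b (2 * (j - 1))" and ?f = "\<lambda>j. b (2 * (j - 1) + 1)"
  have std: "\<sigma> (b i) (b j) = standard_form i j" if "i < 2 * n" "j < 2 * n" for i j
    using assms that by (auto simp: split_basis_def)
  have basis: "inj_on b {..<2 * n}" "module_basis scale (b ` {..<2 * n})"
    using assms basis_on_iff_module_basis[of "{..<2 * n}" b] by (auto simp: split_basis_def)
  have "{..<2 * n} = (\<lambda>j. 2 * (j - 1)) ` {1..n} \<union> (\<lambda>j. 2 * (j - 1) + 1) ` {1..n}"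
  proof (intro equalityI subsetI)
    fix i assume "i \<in> {..<2 * n}"
    then have i: "i div 2 + 1 \<in> {1..n}" by auto
    show "i \<in> (\<lambda>j. 2 * (j - 1)) ` {1..n} \<union> (\<lambda>j. 2 * (j - 1) + 1) ` {1..n}"
    proof (cases "even i")
      case True
      then have "i = 2 * (i div 2 + 1 - 1)" by simp
      with i show ?thesis by blast
    next
      case False
      then have "i = 2 * (i div 2 + 1 - 1) + 1" by simp
      with i show ?thesis by blast
    qed
  qed auto
  then have image: "?e ` {1..n} \<union> ?f ` {1..n} = b ` {..<2 * n}"
    by (simp add: image_Un image_image)
  have "\<sigma> (?e j) (?e l) = 0 \<and> \<sigma> (?f j) (?f l) = 0 \<and> \<sigma> (?f j) (?e l) = (if j = l then 1 else 0)"
    if "j \<in> {1..n}" "l \<in> {1..n}" for j l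
  proof -
    have lt: "2 * (i - 1) < 2 * n" "2 * (i - 1) + 1 < 2 * n" if "i \<in> {1..n}" for i
      using that by auto
    \<comment> \<open>Parity rules out nonzero entries between two \<open>e\<close> or two
      \<open>f\<close> vectors.\<close>
    have "2 * (j - 1) \<noteq> Suc (2 * (l - 1))" "2 * (l - 1) \<noteq> Suc (2 * (j - 1))" by presburger+
    \<comment> \<open>Truncated subtraction is injective here because both indices are at least
      1.\<close>
    moreover have "j - 1 = l - 1 \<longleftrightarrow> j = l" using that by auto
    ultimately show ?thesis
      using that by (simp only: std lt) (simp add: standard_form_def)
  qed
  then show ?thesis
    using basis unfolding symplectic_basis_def image by (simp add: card_image)
qed

end

theorem theorem3p3:
  fixes scale :: "gen_real \<Rightarrow> 'v::ab_group_add \<Rightarrow> 'v"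
    and \<sigma> :: "'v \<Rightarrow> 'v \<Rightarrow> gen_real"
    and m :: nat
  assumes "symplectic_module scale \<sigma>"
    and "free_of_rank scale m"
  shows "even m \<and>
    (\<exists>n. m = 2 * n \<and> (\<exists>e f. symplectic_module.symplectic_basis scale \<sigma> n e f))"
proof -
  interpret symplectic_module scale \<sigma> by (rule assms(1))
  obtain B where B: "module_basis scale B" "finite B" "card B = m"
    using assms(2) by (auto simp: free_of_rank_def)
  then obtain b where "bij_betw b {..<m} B"
    using ex_bij_betw_nat_finite[OF B(2)] by (auto simp: atLeast0LessThan)
  then have basis: "basis_on scale {..<m} b"
    using B by (simp add: basis_on_iff_module_basis bij_betw_def)
  have "even m"
  proof (rule ccontr)
    assume "odd m"
    then obtain k where k: "m = 2 * k + 1" by (rule oddE)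
    then obtain b' where "split_basis m k b'" using split_basis_exists[OF basis, of k] by auto
    \<comment> \<open>After \<open>k\<close> pairs one vector would remain, and the next step would
      demand \<open>2 * k + 1 < m\<close>.\<close>
    with split_basis_step[of m k b'] k show False by simp
  qed
  then obtain n where n: "m = 2 * n" by (rule evenE)
  then obtain b' where "split_basis (2 * n) n b'"
    using split_basis_exists[OF basis, of n] by auto
  then have "symplectic_basis n (\<lambda>j. b' (2 * (j - 1))) (\<lambda>j. b' (2 * (j - 1) + 1))"
    by (rule symplectic_basis_if_split_basis)
  with \<open>even m\<close> n show ?thesis by blast
qed

end
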